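(* Let $\mathscr{H}$ be a Hilbert space, let $r$ be a positive integer, and let $P_1,\ldots,P_r\in\mathbb{B}(\mathscr{H})$ be distinct projections. Let $\{P_i\}_{i=r+1}^\infty$ be a monotonically decreasing sequence of (not necessarily distinct) projections in $\mathbb{B}(\mathscr{H})$. Let $\mathscr{M}_i=\mathcal{R}(P_i)$ be the range of $P_i$ for each $i\in\mathbb{N}$. Let $\sigma:\mathbb{N}\to\mathbb{N}$ be a pseudo-periodic function with $\Gamma_F=\{1,\ldots,r\}$. Set $T_1:=P_{\sigma(1)}$ and $T_n:=P_{\sigma(n)}T_{n-1}$ for $n\ge2$. Then, for every $x\in\mathscr{H}$, the sequence $\{T_nx\}$ converges weakly to $Px$, where $P$ is the projection onto $\bigcap_{i=1}^\infty\mathscr{M}_i$.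
   Context: $\mathbb{B}(\mathscr{H})$ is the algebra of bounded linear operators on $\mathscr{H}$. "Projection" means orthogonal projection ($P^2=P=P^*$). Monotonically decreasing means $P_{r+1}\ge P_{r+2}\ge\cdots$ in the usual operator order, equivalently the ranges are decreasing under inclusion. Weak convergence $x_n\to x$ means $\langle x_n,y\rangle\to\langle x,y\rangle$ for all $y\in\mathscr{H}$. $\mathbb{N}=\{1,2,3,\ldots\}$. Pseudo-periodic functions. Let $\sigma:\mathbb{N}\to\mathbb{N}$ be a function such that for each $j\in\sigma(\mathbb{N})$ the inverse image of $\{j\}$ under $\sigma$ is an infinite set ($\sigma$ is not required to be surjective). For each $j\in\sigma(\mathbb{N})$, let $\{l_n\}_{n=1}^\infty$ (depending on $j$) be the increasing sequence of all natural numbers with $\sigma(l_n)=j$, put $l_0=0$, and let $I(\sigma,j)=\sup_n(l_n-l_{n-1})$. Let $\Gamma_F$ be the set of all such $j$ with $I(\sigma,j)<\infty$ and let $\Gamma_\infty=\sigma(\mathbb{N})\setminus\Gamma_F$, so that $\Gamma_F\cup\Gamma_\infty=\sigma(\mathbb{N})$. Let $\{k_n\}$ be the complement in $\mathbb{N}$ of the union of the sequences $\{l_n\}$ belonging to $j\in\Gamma_F$, written as an increasing sequence; thus $\sigma(k_n)\in\Gamma_\infty$. The function $\sigma$ is called pseudo-periodic if $\Gamma_F=\{1,2,\ldots,r\}$ for some positive integer $r$ and the sequence $\{k_n-k_{n-1}\}$ of differences of consecutive terms is an increasing sequence.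
   Formalization: As stated this fails when Γ_∞ is finite (r=1, P_1=P_2=I, P_i=0 for i≥3, σ=2 on squares, else 1). Proved: the limit is the projection onto the intersection of M_i over i in σ(ℕ), which is the intersection over all i when Γ_∞ is infinite. *)

theory Defs
  imports "HOL-Analysis.Analysis" "HOL-Library.Extended_Nat" "HOL-Library.Infinite_Set"
begin

(* The scalar field is the real or the complex numbers. The class is stated so
   that one theorem covers both; a real normed field with an additive and
   multiplicative conjugation such that z * conj z = |z|^2 is isomorphic to one
   of the two. *)
class rc_field = real_normed_field +
  fixes kconj :: "'a \<Rightarrow> 'a"
  assumes kconj_add: "kconj (x + y) = kconj x + kconj y"
    and kconj_mult: "kconj (x * y) = kconj x * kconj y"
    and mult_kconj: "x * kconj x = ((norm x)\<^sup>2) *\<^sub>R 1"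

instantiation real :: rc_field
begin
definition kconj_real :: "real \<Rightarrow> real" where "kconj_real x = x"
instance by standard (simp_all add: kconj_real_def power2_eq_square)
end

instantiation complex :: rc_field
begin
definition kconj_complex :: "complex \<Rightarrow> complex" where "kconj_complex = cnj"
instance
  by standard (simp_all add: kconj_complex_def scaleR_conv_of_real complex_norm_square del: of_real_power)
end

(* Every Hilbert space over the field 'k is a real Hilbert space under the real
   part of its inner product, and the sort of 'a names that underlying space: it
   supplies the norm, the topology and completeness. The locale adds the
   scalars and the inner product (linear in the first argument) of which the
   norm is the induced one. *)
locale hilbert_space = vector_space smul
  for smul :: "'k::rc_field \<Rightarrow> 'a::{real_inner,complete_space} \<Rightarrow> 'a" +
  fixes ip :: "'a \<Rightarrow> 'a \<Rightarrow> 'k"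
  assumes scale_of_real: "smul (of_real t) x = t *\<^sub>R x"
    and ip_add_left: "ip (x + y) z = ip x z + ip y z"
    and ip_scale_left: "ip (smul c x) y = c * ip x y"
    and ip_commute: "ip y x = kconj (ip x y)"
    and ip_self: "ip x x = of_real ((norm x)\<^sup>2)"

lemma hilbert_space_real:
  "hilbert_space scaleR (inner :: 'a::{real_inner,complete_space} \<Rightarrow> 'a \<Rightarrow> real)"
  by unfold_locales
    (simp_all add: kconj_real_def inner_add_left inner_commute power2_norm_eq_inner algebra_simps)

lemma hilbert_space_complex:
  "hilbert_space (*) (\<lambda>x y::complex. x * cnj y)"
  by unfold_locales
    (simp_all add: kconj_complex_def complex_norm_square scaleR_conv_of_real algebra_simps
      del: of_real_power)

definition bounded_operator ::
    "('k::rc_field \<Rightarrow> 'a::{real_inner,complete_space} \<Rightarrow> 'a) \<Rightarrow> ('a \<Rightarrow> 'a) \<Rightarrow> bool" where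
  "bounded_operator smul A \<longleftrightarrow>
     bounded_linear A \<and> (\<forall>c x. A (smul c x) = smul c (A x))"

definition projection ::
    "('k::rc_field \<Rightarrow> 'a::{real_inner,complete_space} \<Rightarrow> 'a) \<Rightarrow> ('a \<Rightarrow> 'a \<Rightarrow> 'k) \<Rightarrow> ('a \<Rightarrow> 'a) \<Rightarrow> bool"
  where
  "projection smul ip A \<longleftrightarrow>
     bounded_operator smul A \<and> A \<circ> A = A \<and> (\<forall>x y. ip (A x) y = ip x (A y))"

definition op_le ::
    "('a::{real_inner,complete_space} \<Rightarrow> 'a \<Rightarrow> 'k::rc_field) \<Rightarrow> ('a \<Rightarrow> 'a) \<Rightarrow> ('a \<Rightarrow> 'a) \<Rightarrow> bool"
  where
  "op_le ip A B \<longleftrightarrow> (\<forall>x. ip (B x - A x) x \<in> \<real>\<^sub>\<ge>\<^sub>0)"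

definition weakly_converges ::
    "('a::{real_inner,complete_space} \<Rightarrow> 'a \<Rightarrow> 'k::rc_field) \<Rightarrow> (nat \<Rightarrow> 'a) \<Rightarrow> 'a \<Rightarrow> bool"
  where
  "weakly_converges ip u x \<longleftrightarrow> (\<forall>y. (\<lambda>n. ip (u n) y) \<longlonglongrightarrow> ip x y)"

(* Indices are the positive integers, here the nats in {1..}: the values of a
   family P or of s at 0 are never used. In op_product the clause for 0 makes the
   first product P (s 1). *)

primrec op_product :: "(nat \<Rightarrow> 'a \<Rightarrow> 'a) \<Rightarrow> (nat \<Rightarrow> nat) \<Rightarrow> nat \<Rightarrow> 'a \<Rightarrow> 'a" where
  "op_product P s 0 = id"
| "op_product P s (Suc n) = P (s (Suc n)) \<circ> op_product P s n"

definition occurrences :: "(nat \<Rightarrow> nat) \<Rightarrow> nat \<Rightarrow> nat set" where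
  "occurrences s j = {n \<in> {1..}. s n = j}"

definition infinitely_recurrent :: "(nat \<Rightarrow> nat) \<Rightarrow> bool" where
  "infinitely_recurrent s \<longleftrightarrow>
     s ` {1..} \<subseteq> {1..} \<and> (\<forall>j \<in> s ` {1..}. infinite (occurrences s j))"

(* The sequence l_0 = 0 < l_1 < l_2 < ...; enumerate counts from 0. *)
definition occurrence_seq :: "(nat \<Rightarrow> nat) \<Rightarrow> nat \<Rightarrow> nat \<Rightarrow> nat" where
  "occurrence_seq s j n = (if n = 0 then 0 else enumerate (occurrences s j) (n - 1))"

definition max_gap :: "(nat \<Rightarrow> nat) \<Rightarrow> nat \<Rightarrow> enat" where
  "max_gap s j = (SUP n\<in>{1..}. enat (occurrence_seq s j n - occurrence_seq s j (n - 1)))"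

definition Gamma_F :: "(nat \<Rightarrow> nat) \<Rightarrow> nat set" where
  "Gamma_F s = {j \<in> s ` {1..}. max_gap s j < \<infinity>}"

(* This set may be finite. The operators with index above its maximum are then
   never applied, so a weak limit of the products can only be governed by the
   ranges with index in the image of s. If it is infinite, a decreasing tail of
   projections makes the intersection over that image the full intersection. *)
definition Gamma_inf :: "(nat \<Rightarrow> nat) \<Rightarrow> nat set" where
  "Gamma_inf s = s ` {1..} - Gamma_F s"

definition exceptional_times :: "(nat \<Rightarrow> nat) \<Rightarrow> nat set" where
  "exceptional_times s = {1..} - (\<Union>j\<in>Gamma_F s. occurrences s j)"

(* For infinitely recurrent s the set of exceptional times is empty or infinite;
   when it is empty there are no differences to compare. "Increasing" is read as
   non-strict. *)
definition pseudo_periodic :: "(nat \<Rightarrow> nat) \<Rightarrow> bool" where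
  "pseudo_periodic s \<longleftrightarrow>
     infinitely_recurrent s \<and>
     (\<exists>r\<ge>1. Gamma_F s = {1..r}) \<and>
     (exceptional_times s = {} \<or>
      mono (\<lambda>n. enumerate (exceptional_times s) (Suc n) - enumerate (exceptional_times s) n))"

end

theory Submission
  imports Defs
begin

text \<open>
  Write $x_n = T_n x$, and let $Q$ be the projection onto the intersection $M$ of the ranges
  $M_j$, $j \<in> \<sigma>(\<nat>)$. The claim is that $\<langle>x_n - Qx, y\<rangle> \<longrightarrow> 0$ for all $y$. Since $(x_n)$ is
  bounded, the $y$ for which this holds form a closed subspace, and a closed subspace that contains
  $M$ and every kernel $\ker P_j = M_j^\perp$ is the whole space
  (\<open>closed_subspace_eq_UNIV\<close>). So $y$ need only be tested on $M$, where
  $\<langle>x_n, y\<rangle> = \<langle>x, y\<rangle>$ for all $n$, and on $\ker P_j$, where $Qx$ contributes nothing and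
  $\<langle>x_n, y\<rangle> \<longrightarrow> 0$ has to be shown. This reduction takes the place of weak compactness and the
  study of weak cluster points.

  Let $y \<in> \ker P_j$. If $m$ is a time at which $P_j$ was just applied then $\<langle>x_m, y\<rangle> = 0$, so it
  suffices that $x_m - x_n$ is nearly orthogonal to $y$ when $m = m(n)$ is the last such time up to $n$.
  The squared norms $\|x_n\|^2$ decrease to a limit and $m(n) \<longrightarrow> \<infinity>$, so the energy
  $\|x_m\|^2 - \|x_n\|^2$ lost in between tends to $0$. There are two ways to profit from this.

  For $j \<le> r$ the gaps between successive applications of $P_j$ are bounded, and a product of a
  bounded number of projections that loses little energy moves the vector little in norm
  (\<open>norm_displacement_sq_le\<close>).

  For $j > r$ the gaps are unbounded. Here $m(n)$ is taken to be the last time with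
  $\<sigma>(m) \<ge> j$. Because the projections decrease beyond $r$, still $y \<in> \ker P_{\<sigma>(m)}$; and between
  $m$ and $n$ only the finitely many projections of index less than $j$ are applied. The theorem of
  Amemiya and Ando applies: arbitrarily long products of projections from a finite set whose energy
  loss tends to $0$ displace a bounded sequence by a weak null sequence
  (\<open>words_over_finite_alphabet_weak_null\<close>).

  All of this takes place in the underlying real Hilbert space. The transfer to the given scalars
  is possible because the inner product is an explicit expression in its real part.
\<close>

section \<open>Scalars and the underlying real Hilbert space\<close>

lemma kconj_of_real: "kconj (of_real t :: 'k::rc_field) = of_real t"
proof (cases "t = 0")
  case True
  then show ?thesis using kconj_add[of "0::'k" 0] by simp
next
  case False
  have "of_real t * kconj (of_real t :: 'k) = of_real t * of_real t"
    by (simp add: mult_kconj scaleR_conv_of_real power2_eq_square flip: of_real_mult)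
  with False show ?thesis by simp
qed

lemma kconj_minus: "kconj (- z :: 'k::rc_field) = - kconj z"
  using kconj_add[of z "- z"] kconj_of_real[of 0, where 'k='k]
  by (simp add: eq_neg_iff_add_eq_0 add.commute)

context hilbert_space
begin

lemma ip_add_right: "ip x (y + z) = ip x y + ip x z"
  by (metis ip_add_left ip_commute kconj_add)

lemma ip_scale_right: "ip x (smul c y) = kconj c * ip x y"
  by (metis ip_commute ip_scale_left kconj_mult)

lemma ip_diff_left: "ip (x - y) z = ip x z - ip y z"
  by (metis add_diff_cancel diff_add_cancel ip_add_left)

lemma ip_plus_flip: "ip x y + ip y x = of_real (2 * inner x y)"
proof -
  have "ip (x + y) (x + y) = ip x x + ip y y + (ip x y + ip y x)"
    by (simp add: ip_add_left ip_add_right)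
  then have "ip x y + ip y x = of_real ((norm (x + y))\<^sup>2 - (norm x)\<^sup>2 - (norm y)\<^sup>2)"
    by (simp add: ip_self)
  then show ?thesis
    by (simp add: power2_norm_eq_inner inner_add_left inner_add_right inner_commute)
qed

lemma inner_eq_if_ip_of_real: "ip x y = of_real t \<Longrightarrow> inner x y = t"
  using ip_plus_flip[of x y] ip_commute[where x = x and y = y]
  by (simp add: kconj_of_real flip: of_real_add)

text \<open>The vector \<open>smul (ip u y) y\<close> lies on the scalar line of \<open>y\<close> and is rotated so that its product
  with \<open>u\<close> becomes real and nonnegative. Hence a vector that is orthogonal, for the real inner product,
  to a subspace closed under \<open>smul\<close> is also orthogonal to it for \<open>ip\<close>.\<close>

lemma norm_ip_sq: "inner u (smul (ip u y) y) = (norm (ip u y))\<^sup>2"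
proof (rule inner_eq_if_ip_of_real)
  show "ip u (smul (ip u y) y) = of_real ((norm (ip u y))\<^sup>2)"
    using mult_kconj[of "ip u y"]
    by (simp add: ip_scale_right scaleR_conv_of_real mult.commute)
qed

text \<open>Over the complex numbers this is
  $\<langle>u, y\<rangle> = \mathrm{Re}\<langle>u, y\<rangle> + i\,\mathrm{Re}\<langle>u, iy\<rangle>$. For an abstract scalar
  field, the part of $i$ is played by any nonzero scalar with $\bar k = -k$; if there is none, then
  \<open>ip u y - ip y u\<close> vanishes and \<open>ip\<close> is already real.\<close>

lemma ip_from_inner: "\<exists>s t. \<forall>u y. ip u y = of_real (inner u y) + s * of_real (inner u (smul t y))"
proof (cases "\<exists>k :: 'k. k \<noteq> 0 \<and> kconj k = - k")
  case True
  then obtain k :: 'k where k: "k \<noteq> 0" "kconj k = - k" by blast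
  have "ip u y = of_real (inner u y) + inverse k * of_real (inner u (smul (- k) y))" for u y
  proof -
    have "k * (ip u y - ip y u) = of_real (2 * inner u (smul (- k) y))"
      using ip_plus_flip[of u "smul (- k) y"] k(2)
      by (simp add: ip_scale_left ip_scale_right kconj_minus algebra_simps del: scale_minus_left)
    then have "ip u y - ip y u = inverse k * of_real (2 * inner u (smul (- k) y))"
      using k(1) by (metis (no_types) left_inverse mult.assoc mult_1)
    moreover have "2 * ip u y = (ip u y - ip y u) + (ip u y + ip y u)" by simp
    ultimately have "2 * ip u y = inverse k * of_real (2 * inner u (smul (- k) y)) + of_real (2 * inner u y)"
      by (simp only: ip_plus_flip)
    then have "2 * ip u y = 2 * (of_real (inner u y) + inverse k * of_real (inner u (smul (- k) y)))"
      by (simp add: algebra_simps del: scale_minus_left)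
    then show ?thesis by (metis mult_cancel_left zero_neq_numeral)
  qed
  then show ?thesis by blast
next
  case False
  have "ip u y = of_real (inner u y) + 0 * of_real (inner u (smul 0 y))" for u y
  proof -
    have "kconj (ip u y + - ip y u) = ip y u + - ip u y"
      by (simp only: kconj_add kconj_minus ip_commute[symmetric])
    then have "kconj (ip u y - ip y u) = - (ip u y - ip y u)" by simp
    then have "ip u y = ip y u" using False right_minus_eq by blast
    then show ?thesis using ip_plus_flip[of u y] by simp
  qed
  then show ?thesis by blast
qed

lemma weakly_converges_ip:
  assumes "weakly_converges inner u x"
  shows "weakly_converges ip u x"
proof -
  obtain s t where st: "\<And>u y. ip u y = of_real (inner u y) + s * of_real (inner u (smul t y))"
    using ip_from_inner by blast
  have lim: "(\<lambda>n. inner (u n) y) \<longlonglongrightarrow> inner x y" for y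
    using assms by (simp add: weakly_converges_def)
  show ?thesis
    unfolding weakly_converges_def st by (intro allI tendsto_intros lim)
qed

lemma projection_inner:
  assumes "projection smul ip A"
  shows "projection scaleR inner A"
proof -
  have bl: "bounded_linear A" and idem: "A \<circ> A = A"
    and sym: "\<And>x y. ip (A x) y = ip x (A y)"
    using assms unfolding projection_def bounded_operator_def by blast+
  have "inner (A x) y = inner x (A y)" for x y
  proof -
    have "(of_real (2 * inner (A x) y) :: 'k) = of_real (2 * inner x (A y))"
      using ip_plus_flip[of "A x" y] ip_plus_flip[of x "A y"] sym[of x y] sym[of y x] by argo
    then have "2 * inner (A x) y = 2 * inner x (A y)" by (rule of_real_eq_iff[THEN iffD1])
    then show ?thesis by simp
  qed
  then show ?thesis
    using bl idem linear_cmul[OF bounded_linear.linear[OF bl]]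
    by (simp add: projection_def bounded_operator_def)
qed

end

section \<open>Orthogonal projections\<close>

lemma projectionD:
  assumes "projection scaleR inner A"
  shows "bounded_linear A" "A (A x) = A x" "inner (A x) y = inner x (A y)"
  using assms by (auto simp: projection_def bounded_operator_def o_def fun_eq_iff)

lemma projection_range_iff:
  assumes "projection scaleR inner A"
  shows "x \<in> range A \<longleftrightarrow> A x = x"
  by (metis assms projectionD(2) rangeE rangeI)

lemma projection_pythagoras:
  assumes "projection scaleR inner A"
  shows "(norm x)\<^sup>2 = (norm (A x))\<^sup>2 + (norm (x - A x))\<^sup>2"
proof -
  have "inner (A x) (A x) = inner x (A x)"
    using projectionD[OF assms] by metis
  then show ?thesis
    by (simp add: power2_norm_eq_inner inner_diff_left inner_diff_right inner_commute)
qed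

lemma projection_inner_self:
  assumes "projection scaleR inner A"
  shows "inner (A x) x = (norm (A x))\<^sup>2"
  by (metis assms power2_norm_eq_inner projectionD(2,3))

lemma closed_subspace_range_projection:
  assumes "projection scaleR inner A"
  shows "closed (range A)" "subspace (range A)"
proof -
  interpret bounded_linear A by (rule projectionD[OF assms])
  have "range A = {x. A x = x}" using projection_range_iff[OF assms] by auto
  moreover have "closed {x. A x = x}"
    by (intro closed_Collect_eq continuous_intros continuous_on)
  ultimately show "closed (range A)" by simp
  show "subspace (range A)"
    by (intro linear_subspace_image subspace_UNIV linear_axioms)
qed

text \<open>A sequence in \<open>M\<close> whose distance to \<open>x\<close> tends to the infimum is Cauchy by the parallelogram law,
  as the midpoints of its members also lie in \<open>M\<close>. Its limit is the nearest point, and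
  minimality along the lines through that point gives orthogonality.\<close>

lemma orthogonal_decomposition_exists:
  fixes x :: "'a::{real_inner,complete_space}"
  assumes M: "closed M" "subspace M"
  shows "\<exists>m\<in>M. \<forall>v\<in>M. inner (x - m) v = 0"
proof -
  define D where "D = (INF m\<in>M. (norm (x - m))\<^sup>2)"
  have ne: "M \<noteq> {}" using M(2) subspace_0 by blast
  have bdd: "bdd_below ((\<lambda>m. (norm (x - m))\<^sup>2) ` M)"
    by (rule bdd_belowI[of _ 0]) auto
  have D: "D \<le> (norm (x - m))\<^sup>2" if "m \<in> M" for m
    unfolding D_def by (rule cINF_lower[OF bdd that])
  have "\<exists>m\<in>M. (norm (x - m))\<^sup>2 < D + inverse (Suc n)" for n
    using cINF_less_iff[OF ne bdd, of "D + inverse (Suc n)"] by (simp add: D_def)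
  then obtain f where f: "\<And>n. f n \<in> M" "\<And>n. (norm (x - f n))\<^sup>2 < D + inverse (Suc n)"
    by metis
  have para: "(norm (f i - f j))\<^sup>2 \<le> 2 * inverse (Suc i) + 2 * inverse (Suc j)" for i j
  proof -
    have "(1/2) *\<^sub>R (f i + f j) \<in> M"
      by (intro subspace_scale subspace_add M f)
    then have "D \<le> (norm (x - (1/2) *\<^sub>R (f i + f j)))\<^sup>2" by (rule D)
    moreover have "(norm (f i - f j))\<^sup>2 + 4 * (norm (x - (1/2) *\<^sub>R (f i + f j)))\<^sup>2
        = 2 * (norm (x - f i))\<^sup>2 + 2 * (norm (x - f j))\<^sup>2"
      by (simp add: power2_norm_eq_inner algebra_simps inner_commute)
    ultimately show ?thesis using f(2)[of i] f(2)[of j] by linarith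
  qed
  have "Cauchy f"
  proof (rule metric_CauchyI)
    fix e :: real assume e: "e > 0"
    obtain N where N: "inverse (Suc N) < e\<^sup>2 / 4"
      using reals_Archimedean[of "e\<^sup>2 / 4"] e by auto
    have "dist (f i) (f j) < e" if "i \<ge> N" "j \<ge> N" for i j
    proof -
      have "inverse (real (Suc i)) \<le> inverse (Suc N)" "inverse (real (Suc j)) \<le> inverse (Suc N)"
        using that by (simp_all add: field_simps)
      then have "(norm (f i - f j))\<^sup>2 < e\<^sup>2" using para[of i j] N by linarith
      then show ?thesis using e by (simp add: dist_norm power2_less_imp_less)
    qed
    then show "\<exists>N. \<forall>i\<ge>N. \<forall>j\<ge>N. dist (f i) (f j) < e" by blast
  qed
  then obtain m where m: "f \<longlonglongrightarrow> m" using Cauchy_convergent convergent_def by blast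
  have mM: "m \<in> M" using M(1) f(1) m closed_sequentially by blast
  have "(norm (x - m))\<^sup>2 \<le> D + 0"
  proof (rule LIMSEQ_le)
    show "(\<lambda>n. (norm (x - f n))\<^sup>2) \<longlonglongrightarrow> (norm (x - m))\<^sup>2" by (intro tendsto_intros m)
    show "(\<lambda>n. D + inverse (real (Suc n))) \<longlonglongrightarrow> D + 0"
      by (intro tendsto_intros LIMSEQ_inverse_real_of_nat)
  qed (use f(2) in \<open>auto intro: less_imp_le\<close>)
  then have min: "(norm (x - m))\<^sup>2 \<le> (norm (x - v))\<^sup>2" if "v \<in> M" for v
    using D[OF that] by linarith
  have "inner (x - m) v = 0" if v: "v \<in> M" for v
  proof (cases "v = 0")
    case False
    define t where "t = inner (x - m) v / inner v v"
    \<comment> \<open>This \<open>t\<close> gives the point on the line through \<open>m\<close> in direction \<open>v\<close> that is nearest to \<open>x\<close>.\<close>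
    have "m + t *\<^sub>R v \<in> M" by (intro subspace_add subspace_scale M mM v)
    from min[OF this] have "inner (x - m) v * t * 2 \<le> t * t * inner v v"
      by (simp add: power2_norm_eq_inner algebra_simps inner_commute)
    moreover have "t * inner v v = inner (x - m) v" using False by (simp add: t_def)
    ultimately have "t * t * inner v v \<le> 0" by (simp add: mult.assoc mult.commute)
    then have "t = 0" using False
      by (metis inner_gt_zero_iff mult_le_0_iff not_less order_antisym_conv mult_eq_0_iff zero_le_square)
    then show ?thesis using False by (simp add: t_def)
  qed simp
  then show ?thesis using mM by blast
qed

lemma projection_onto_exists:
  fixes M :: "'a::{real_inner,complete_space} set"
  assumes M: "closed M" "subspace M"
  shows "\<exists>Q. projection scaleR inner Q \<and> range Q = M"
proof -
  obtain Q where Q: "\<And>x. Q x \<in> M" "\<And>x v. v \<in> M \<Longrightarrow> inner (x - Q x) v = 0"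
    using orthogonal_decomposition_exists[OF M] by metis
  have uniq: "Q x = m" if m: "m \<in> M" and orth: "\<And>v. v \<in> M \<Longrightarrow> inner (x - m) v = 0" for x m
  proof -
    have "Q x - m \<in> M" by (intro subspace_diff M Q m)
    then have "inner ((x - m) - (x - Q x)) (Q x - m) = 0"
      using orth Q(2) by (simp only: inner_diff_left[of "x - m"])
    moreover have "(x - m) - (x - Q x) = Q x - m" by simp
    ultimately show ?thesis by (metis eq_iff_diff_eq_0 inner_eq_zero_iff)
  qed
  have add: "Q (x + y) = Q x + Q y" for x y
  proof (rule uniq)
    fix v assume v: "v \<in> M"
    have "x + y - (Q x + Q y) = (x - Q x) + (y - Q y)" by simp
    then show "inner (x + y - (Q x + Q y)) v = 0" using Q(2)[OF v] by (simp only: inner_add_left)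
  qed (intro subspace_add M Q)
  have scale: "Q (c *\<^sub>R x) = c *\<^sub>R Q x" for c x
  proof (rule uniq)
    fix v assume v: "v \<in> M"
    show "inner (c *\<^sub>R x - c *\<^sub>R Q x) v = 0"
      using Q(2)[OF v, of x] by (simp flip: scaleR_diff_right)
  qed (intro subspace_scale M Q)
  have fixed: "Q m = m" if "m \<in> M" for m using that by (intro uniq) auto
  have QQ: "inner (Q x) (Q y) = inner x (Q y)" for x y
    using Q(2)[OF Q(1), of x y] by (simp add: inner_diff_left)
  have "norm (Q x) \<le> norm x * 1" for x
  proof -
    have "norm (Q x) * norm (Q x) \<le> norm x * norm (Q x)"
      using QQ[of x x] Cauchy_Schwarz_ineq2[of x "Q x"]
      by (metis abs_le_D1 power2_eq_square power2_norm_eq_inner)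
    then show ?thesis by (cases "Q x = 0") auto
  qed
  then have "bounded_linear Q" using add scale by (intro bounded_linear_intro[where K = 1]) auto
  moreover have "inner (Q x) y = inner x (Q y)" for x y
    using QQ[of x y] QQ[of y x] by (simp add: inner_commute)
  ultimately have "projection scaleR inner Q"
    using fixed Q(1) by (simp add: projection_def bounded_operator_def scale fun_eq_iff)
  moreover have "range Q = M" using Q(1) fixed by (metis image_subset_iff rangeI subsetI subset_antisym)
  ultimately show ?thesis by blast
qed

lemma projection_onto_intersection:
  fixes P :: "'i \<Rightarrow> 'a::{real_inner,complete_space} \<Rightarrow> 'a"
  assumes "\<And>i. i \<in> I \<Longrightarrow> projection scaleR inner (P i)"
  shows "\<exists>Q. projection scaleR inner Q \<and> range Q = (\<Inter>i\<in>I. range (P i))"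
proof (rule projection_onto_exists)
  show "closed (\<Inter>i\<in>I. range (P i))"
    using closed_subspace_range_projection(1)[OF assms] by (intro closed_INT ballI)
  show "subspace (\<Inter>i\<in>I. range (P i))"
    using closed_subspace_range_projection(2)[OF assms] by (intro subspace_Inter) auto
qed

text \<open>The converse of \<open>projection_inner\<close> fails for a general real projection: its range has to be
  invariant under the scalars, and then so is the orthogonal complement.\<close>

lemma (in hilbert_space) projection_ip:
  assumes Q: "projection scaleR inner Q" and inv: "\<And>c y. y \<in> range Q \<Longrightarrow> smul c y \<in> range Q"
  shows "projection smul ip Q"
proof -
  interpret Q: bounded_linear Q by (rule projectionD[OF Q])
  note [simp] = projectionD(2)[OF Q]
  have orth: "ip u y = 0" if u: "Q u = 0" and y: "y \<in> range Q" for u y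
  proof -
    obtain z where "smul (ip u y) y = Q z" using inv[OF y] by blast
    then have "inner u (smul (ip u y) y) = 0"
      using projectionD(3)[OF Q, of u z] u by simp
    then show ?thesis by (simp add: norm_ip_sq)
  qed
  have left: "ip (Q x) (Q y) = ip x (Q y)" for x y
    using orth[of "x - Q x" "Q y"] by (simp add: Q.diff ip_diff_left)
  have sym: "ip (Q x) y = ip x (Q y)" for x y
    using left by (metis ip_commute)
  have "Q (smul c x) = smul c (Q x)" for c x
  proof -
    have "Q (smul c (x - Q x)) = 0"
    proof -
      let ?v = "Q (smul c (x - Q x))"
      have "ip ?v ?v = c * ip (Q (x - Q x)) ?v"
        by (metis ip_scale_left left sym)
      then have "ip ?v ?v = 0"
        using ip_scale_left[of 0 ?v ?v] by (simp add: Q.diff Q.zero)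
      then show ?thesis by (simp add: ip_self)
    qed
    moreover have "Q (smul c (Q x)) = smul c (Q x)"
      using inv[of "Q x" c] projection_range_iff[OF Q] by simp
    ultimately show ?thesis by (simp add: scale_right_diff_distrib Q.diff)
  qed
  then show ?thesis
    using sym Q.bounded_linear_axioms by (simp add: projection_def bounded_operator_def fun_eq_iff)
qed

text \<open>If \<open>z\<close> is orthogonal to \<open>Y\<close>, then it is orthogonal to its own component \<open>z - P j z\<close> in the
  kernel of \<open>P j\<close>, which therefore vanishes. So \<open>z\<close> lies in all the ranges, hence in \<open>Y\<close>, hence \<open>z = 0\<close>.\<close>

lemma closed_subspace_eq_UNIV:
  fixes Y :: "'a::{real_inner,complete_space} set"
  assumes Y: "closed Y" "subspace Y"
    and P: "\<And>j. j \<in> L \<Longrightarrow> projection scaleR inner (P j)"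
    and range: "(\<Inter>j\<in>L. range (P j)) \<subseteq> Y"
    and ker: "\<And>j y. j \<in> L \<Longrightarrow> P j y = 0 \<Longrightarrow> y \<in> Y"
  shows "Y = UNIV"
proof -
  have "y \<in> Y" for y
  proof -
    obtain m where m: "m \<in> Y" "\<And>v. v \<in> Y \<Longrightarrow> inner (y - m) v = 0"
      using orthogonal_decomposition_exists[OF Y] by blast
    let ?z = "y - m"
    have Pz: "P j ?z = ?z" if j: "j \<in> L" for j
    proof -
      note p = projectionD[OF P[OF j]]
      interpret bounded_linear "P j" by (rule p)
      have "P j (?z - P j ?z) = 0" by (simp only: diff p(2)) simp
      then have "inner ?z (?z - P j ?z) = 0" using m(2) ker[OF j] by blast
      then have "(norm (?z - P j ?z))\<^sup>2 = 0"
        using projection_inner_self[OF P[OF j], of ?z] projection_pythagoras[OF P[OF j], of ?z]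
        by (simp only: inner_diff_right inner_commute power2_norm_eq_inner)
      then show ?thesis by simp
    qed
    have "?z \<in> (\<Inter>j\<in>L. range (P j))"
    proof
      show "?z \<in> range (P j)" if "j \<in> L" for j using Pz[OF that, symmetric] by (rule range_eqI)
    qed
    then have "?z \<in> Y" using range by (rule rev_subsetD)
    then have "inner ?z ?z = 0" by (rule m(2))
    then show ?thesis using m(1) by simp
  qed
  then show ?thesis by blast
qed

lemma closed_subspace_weak_null:
  fixes u :: "nat \<Rightarrow> 'a::real_inner"
  assumes "\<And>n. norm (u n) \<le> B"
  shows "closed {y. (\<lambda>n. inner (u n) y) \<longlonglongrightarrow> 0}" "subspace {y. (\<lambda>n. inner (u n) y) \<longlonglongrightarrow> 0}"
proof -
  have B: "B \<ge> 0" using assms[of 0] norm_ge_zero order_trans by blast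
  show "closed {y. (\<lambda>n. inner (u n) y) \<longlonglongrightarrow> 0}"
    unfolding closure_subset_eq[symmetric] subset_iff closure_approachable
  proof (intro allI impI CollectI)
    fix y assume near: "\<forall>e>0. \<exists>z\<in>{y. (\<lambda>n. inner (u n) y) \<longlonglongrightarrow> 0}. dist z y < e"
    show "(\<lambda>n. inner (u n) y) \<longlonglongrightarrow> 0"
    proof (rule LIMSEQ_I)
      fix e :: real assume e: "e > 0"
      then obtain z where z: "(\<lambda>n. inner (u n) z) \<longlonglongrightarrow> 0" "dist z y < e / (2 * (B + 1))"
        using near B by (metis add_nonneg_pos divide_pos_pos mem_Collect_eq mult_pos_pos zero_less_numeral zero_less_one)
      obtain N where N: "\<And>n. n \<ge> N \<Longrightarrow> norm (inner (u n) z) < e / 2"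
        using LIMSEQ_D[OF z(1), of "e / 2"] e by auto
      have "norm (inner (u n) y - 0) < e" if "n \<ge> N" for n
      proof -
        have "\<bar>inner (u n) (y - z)\<bar> \<le> norm (u n) * norm (y - z)" by (rule Cauchy_Schwarz_ineq2)
        also have "\<dots> \<le> (B + 1) * (e / (2 * (B + 1)))"
          using assms[of n] z(2) B by (intro mult_mono) (auto simp: dist_norm norm_minus_commute)
        also have "\<dots> = e / 2" using B by (simp add: divide_simps)
        finally show ?thesis using N[OF that] by (simp only: inner_diff_right real_norm_def diff_0_right)
      qed
      then show "\<exists>N. \<forall>n\<ge>N. norm (inner (u n) y - 0) < e" by blast
    qed
  qed
  show "subspace {y. (\<lambda>n. inner (u n) y) \<longlonglongrightarrow> 0}"
    unfolding subspace_def
    by (auto simp: inner_add_right intro: tendsto_add_zero tendsto_mult_right_zero)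
qed

section \<open>Products of projections as words\<close>

text \<open>The word \<open>w\<close> stands for the operator \<open>fold P w\<close>, in which the first letter of \<open>w\<close> acts first.\<close>

definition energy_loss :: "('i \<Rightarrow> 'a::real_inner \<Rightarrow> 'a) \<Rightarrow> 'i list \<Rightarrow> 'a \<Rightarrow> real" where
  "energy_loss P w x = (norm x)\<^sup>2 - (norm (fold P w x))\<^sup>2"

lemma energy_loss_simps:
  "energy_loss P [] x = 0"
  "energy_loss P (i # w) x = energy_loss P [i] x + energy_loss P w (P i x)"
  "energy_loss P (v @ w) x = energy_loss P v x + energy_loss P w (fold P v x)"
  by (simp_all add: energy_loss_def)

lemma energy_loss_single:
  "projection scaleR inner (P i) \<Longrightarrow> energy_loss P [i] x = (norm (x - P i x))\<^sup>2"
  using projection_pythagoras[of "P i" x] by (simp add: energy_loss_def)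

lemma energy_loss_nonneg:
  assumes "\<And>i. i \<in> set w \<Longrightarrow> projection scaleR inner (P i)"
  shows "energy_loss P w x \<ge> 0"
  using assms
proof (induction w arbitrary: x)
  case (Cons i w)
  have "energy_loss P w (P i x) \<ge> 0" using Cons by simp
  then show ?case
    using energy_loss_simps(2)[of P i w x] energy_loss_single[of P i x] Cons.prems by simp
qed (simp add: energy_loss_simps(1))

lemma norm_fold_le:
  assumes "\<And>i. i \<in> set w \<Longrightarrow> projection scaleR inner (P i)"
  shows "norm (fold P w x) \<le> norm x"
  using energy_loss_nonneg[where P = P and w = w and x = x, OF assms] by (simp add: energy_loss_def)

text \<open>By Pythagoras the energy loss is the sum of the squared lengths of the single steps, so this is
  the Cauchy-Schwarz inequality for the sum of the steps.\<close>

lemma norm_displacement_sq_le: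
  assumes "\<And>i. i \<in> set w \<Longrightarrow> projection scaleR inner (P i)"
  shows "(norm (x - fold P w x))\<^sup>2 \<le> length w * energy_loss P w x"
  using assms
proof (induction w arbitrary: x)
  case (Cons i w)
  define a where "a = norm (x - P i x)"
  define b where "b = norm (P i x - fold P w (P i x))"
  define k where "k = real (length w)"
  define E where "E = energy_loss P w (P i x)"
  have b: "b\<^sup>2 \<le> k * E" using Cons.IH[of "P i x"] Cons.prems by (simp add: b_def k_def E_def)
  have E: "E \<ge> 0" unfolding E_def using Cons.prems by (intro energy_loss_nonneg) auto
  \<comment> \<open>This is \<open>2 * a * b \<le> k * a\<^sup>2 + b\<^sup>2 / k\<close>, which turns \<open>(a + b)\<^sup>2\<close> into \<open>k + 1\<close> times the loss.\<close>
  have ab: "2 * a * b \<le> k * a\<^sup>2 + E"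
  proof (cases "k = 0")
    case True
    then show ?thesis using b E by simp
  next
    case False
    then have k: "k > 0" by (simp add: k_def)
    have "0 \<le> (k * a - b)\<^sup>2" by simp
    then have "k * (2 * a * b) \<le> k * (k * a\<^sup>2 + E)"
      using b by (simp add: power2_eq_square algebra_simps)
    then show ?thesis using k by simp
  qed
  have "norm (x - fold P (i # w) x) \<le> a + b"
    unfolding a_def b_def using norm_triangle_ineq[of "x - P i x" "P i x - fold P w (P i x)"] by simp
  then have "(norm (x - fold P (i # w) x))\<^sup>2 \<le> (a + b)\<^sup>2" by (intro power_mono) auto
  also have "\<dots> \<le> (1 + k) * (a\<^sup>2 + E)"
    using ab b by (simp add: power2_eq_square algebra_simps)
  also have "a\<^sup>2 + E = energy_loss P (i # w) x"
    using energy_loss_simps(2)[of P i w x] energy_loss_single[of P i x] Cons.prems by (simp add: a_def E_def)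
  finally show ?case by (simp add: k_def)
qed (simp add: energy_loss_def)

lemma inner_fold_fixed:
  assumes "\<And>i. i \<in> set w \<Longrightarrow> projection scaleR inner (P i) \<and> P i y = y"
  shows "inner (fold P w x) y = inner x y"
  using assms by (induction w arbitrary: x) (auto simp: projectionD(3))

text \<open>The induction step for the theorem of Amemiya and Ando. Cut \<open>w\<close> at the first occurrence of \<open>j\<close>, with
  prefix \<open>u\<close>, and at the last occurrence of \<open>j\<close>, with suffix \<open>v\<close>. Directly after a letter \<open>j\<close> the vector
  is orthogonal to \<open>y\<close>. So \<open>inner x y\<close> is controlled by the displacement along \<open>u\<close> and the one step \<open>j\<close>
  that follows, and the product with \<open>y\<close> after the whole of \<open>w\<close> is controlled by the displacement along
  \<open>v\<close>. Neither \<open>u\<close> nor \<open>v\<close> contains \<open>j\<close>. If \<open>j\<close> does not occur in \<open>w\<close>, take \<open>u = w\<close> and the empty \<open>v\<close>.\<close>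

lemma split_at_letter:
  assumes P: "\<And>i. i \<in> set w \<Longrightarrow> projection scaleR inner (P i)" and y: "P j y = 0"
  shows "\<exists>u v z. set u \<subseteq> set w - {j} \<and> set v \<subseteq> set w - {j} \<and> norm z \<le> norm x \<and>
    energy_loss P u x \<le> energy_loss P w x \<and> energy_loss P v z \<le> energy_loss P w x \<and>
    \<bar>inner (x - fold P w x) y\<bar> \<le> \<bar>inner (x - fold P u x) y\<bar>
       + sqrt (energy_loss P w x) * norm y + \<bar>inner (z - fold P v z) y\<bar>"
proof (cases "j \<in> set w")
  case False
  then show ?thesis
    using energy_loss_nonneg[where P = P and w = w and x = x, OF P]
    by (intro exI[of _ w] exI[of _ "[]"] exI[of _ x]) (auto simp: energy_loss_simps)
next
  case True
  then have Pj: "projection scaleR inner (P j)" by (rule P)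
  obtain u a where u: "w = u @ j # a" "j \<notin> set u" using split_list_first[OF True] by blast
  obtain b v where v: "w = b @ j # v" "j \<notin> set v" using split_list_last[OF True] by blast
  define z where "z = fold P (b @ [j]) x"
  define q where "q = fold P u x"
  have kill: "inner (P j t) y = 0" for t using projectionD(3)[OF Pj] y by simp
  have "energy_loss P w x = energy_loss P u x + (energy_loss P [j] q + energy_loss P a (P j q))"
    unfolding u(1) energy_loss_simps(3) q_def by (subst energy_loss_simps(2)) simp
  moreover have "energy_loss P u x \<ge> 0" "energy_loss P a (P j q) \<ge> 0" "energy_loss P [j] q \<ge> 0"
    by (intro energy_loss_nonneg P; simp add: u)+
  ultimately have eu: "energy_loss P u x \<le> energy_loss P w x"
    and ej: "energy_loss P [j] q \<le> energy_loss P w x" by linarith+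
  have "energy_loss P w x = energy_loss P (b @ [j]) x + energy_loss P v z"
    unfolding z_def energy_loss_simps(3)[symmetric] by (simp add: v)
  moreover have "energy_loss P (b @ [j]) x \<ge> 0"
    by (intro energy_loss_nonneg P) (auto simp: v)
  ultimately have ev: "energy_loss P v z \<le> energy_loss P w x" by linarith
  have nz: "norm z \<le> norm x" unfolding z_def by (intro norm_fold_le P) (auto simp: v)
  have "norm (q - P j q) \<le> sqrt (energy_loss P w x)"
    using ej by (intro real_le_rsqrt) (simp add: energy_loss_single[of P j, OF Pj])
  then have step: "\<bar>inner (q - P j q) y\<bar> \<le> sqrt (energy_loss P w x) * norm y"
    by (meson Cauchy_Schwarz_ineq2 mult_right_mono norm_ge_zero order_trans)
  have wz: "fold P w x = fold P v z" by (simp add: v z_def)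
  have "inner z y = 0" using kill by (simp add: z_def)
  then have "inner (x - fold P w x) y =
      inner (x - q) y + inner (q - P j q) y + inner (z - fold P v z) y"
    using kill[of q] by (simp add: wz inner_diff_left)
  with step have "\<bar>inner (x - fold P w x) y\<bar> \<le> \<bar>inner (x - q) y\<bar>
       + sqrt (energy_loss P w x) * norm y + \<bar>inner (z - fold P v z) y\<bar>" by linarith
  moreover have "set u \<subseteq> set w - {j}" using u by auto
  moreover have "set v \<subseteq> set w - {j}" using v by auto
  ultimately show ?thesis using eu ev nz unfolding q_def by blast
qed

text \<open>The theorem of Amemiya and Ando. The words may have any length, so \<open>norm_displacement_sq_le\<close> gives
  nothing here. For \<open>y\<close> in the kernel of \<open>P j\<close> with \<open>j \<in> L\<close>, cutting the words at \<open>j\<close>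
  reduces the claim to the alphabet \<open>L - {j}\<close>; vectors fixed by all \<open>P j\<close> are orthogonal to every
  displacement; and these two kinds of \<open>y\<close> suffice.\<close>

lemma words_over_finite_alphabet_weak_null:
  fixes P :: "'i \<Rightarrow> 'a::{real_inner,complete_space} \<Rightarrow> 'a"
  assumes "finite L"
    and "\<And>j. j \<in> L \<Longrightarrow> projection scaleR inner (P j)"
    and "\<And>n. set (W n) \<subseteq> L" and "\<And>n. norm (X n) \<le> B"
    and "(\<lambda>n. energy_loss P (W n) (X n)) \<longlonglongrightarrow> 0"
  shows "(\<lambda>n. inner (X n - fold P (W n) (X n)) y) \<longlonglongrightarrow> 0"
  using assms
proof (induction L arbitrary: W X y rule: finite_psubset_induct)
  case (psubset L)
  note P = psubset.prems(1) and W = psubset.prems(2) and X = psubset.prems(3) and loss = psubset.prems(4)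
  let ?Y = "{y. (\<lambda>n. inner (X n - fold P (W n) (X n)) y) \<longlonglongrightarrow> 0}"
  have PW: "projection scaleR inner (P i)" if "i \<in> set (W n)" for i n using that W P by blast
  have bd: "norm (X n - fold P (W n) (X n)) \<le> B + B" for n
  proof -
    have "norm (fold P (W n) (X n)) \<le> norm (X n)" by (rule norm_fold_le) (rule PW)
    then show ?thesis using X[of n] norm_triangle_ineq4[of "X n" "fold P (W n) (X n)"] by linarith
  qed
  have "?Y = UNIV"
  proof (rule closed_subspace_eq_UNIV[OF closed_subspace_weak_null[OF bd] P])
    show "(\<Inter>j\<in>L. range (P j)) \<subseteq> ?Y"
    proof
      fix y assume "y \<in> (\<Inter>j\<in>L. range (P j))"
      then have "P i y = y" if "i \<in> L" for i
        using that projection_range_iff[OF P] by blast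
      then have "inner (fold P (W n) (X n)) y = inner (X n) y" for n
        using W P by (intro inner_fold_fixed) blast
      then show "y \<in> ?Y" by (simp add: inner_diff_left)
    qed
  next
    fix j y assume j: "j \<in> L" and y: "P j y = 0"
    have "\<forall>n. \<exists>u v z. set u \<subseteq> set (W n) - {j} \<and> set v \<subseteq> set (W n) - {j} \<and> norm z \<le> norm (X n) \<and>
      energy_loss P u (X n) \<le> energy_loss P (W n) (X n) \<and> energy_loss P v z \<le> energy_loss P (W n) (X n) \<and>
      \<bar>inner (X n - fold P (W n) (X n)) y\<bar> \<le> \<bar>inner (X n - fold P u (X n)) y\<bar>
         + sqrt (energy_loss P (W n) (X n)) * norm y + \<bar>inner (z - fold P v z) y\<bar>"
      by (intro allI split_at_letter[of _ P j y, OF _ y] PW)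
    then obtain U V Z where
      UV: "\<And>n. set (U n) \<subseteq> set (W n) - {j}" "\<And>n. set (V n) \<subseteq> set (W n) - {j}"
        "\<And>n. norm (Z n) \<le> norm (X n)"
      and lU: "\<And>n. energy_loss P (U n) (X n) \<le> energy_loss P (W n) (X n)"
      and lV: "\<And>n. energy_loss P (V n) (Z n) \<le> energy_loss P (W n) (X n)"
      and bound: "\<And>n. \<bar>inner (X n - fold P (W n) (X n)) y\<bar> \<le> \<bar>inner (X n - fold P (U n) (X n)) y\<bar>
         + sqrt (energy_loss P (W n) (X n)) * norm y + \<bar>inner (Z n - fold P (V n) (Z n)) y\<bar>"
      by metis
    have sub: "L - {j} \<subset> L" using j by blast
    have "set (U n) \<subseteq> L - {j}" "set (V n) \<subseteq> L - {j}" "norm (Z n) \<le> B" for n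
      using UV[of n] W[of n] X[of n] by auto
    note UVL = this
    have "energy_loss P (U n) (X n) \<ge> 0" "energy_loss P (V n) (Z n) \<ge> 0" for n
      using UVL[of n] P by (auto intro!: energy_loss_nonneg)
    then have zU: "(\<lambda>n. energy_loss P (U n) (X n)) \<longlonglongrightarrow> 0"
      and zV: "(\<lambda>n. energy_loss P (V n) (Z n)) \<longlonglongrightarrow> 0"
      using lU lV by (auto intro!: tendsto_sandwich[OF _ _ tendsto_const loss] always_eventually)
    have iU: "(\<lambda>n. inner (X n - fold P (U n) (X n)) y) \<longlonglongrightarrow> 0"
      by (rule psubset.IH[OF sub _ UVL(1) X zU]) (use P in blast)
    have iV: "(\<lambda>n. inner (Z n - fold P (V n) (Z n)) y) \<longlonglongrightarrow> 0"
      by (rule psubset.IH[OF sub _ UVL(2) UVL(3) zV]) (use P in blast)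
    have "(\<lambda>n. \<bar>inner (X n - fold P (U n) (X n)) y\<bar>
         + sqrt (energy_loss P (W n) (X n)) * norm y + \<bar>inner (Z n - fold P (V n) (Z n)) y\<bar>)
        \<longlonglongrightarrow> \<bar>0\<bar> + sqrt 0 * norm y + \<bar>0\<bar>"
      by (intro tendsto_intros iU iV loss)
    then have lim: "(\<lambda>n. \<bar>inner (X n - fold P (U n) (X n)) y\<bar>
         + sqrt (energy_loss P (W n) (X n)) * norm y + \<bar>inner (Z n - fold P (V n) (Z n)) y\<bar>)
        \<longlonglongrightarrow> 0" by simp
    have "(\<lambda>n. inner (X n - fold P (W n) (X n)) y) \<longlonglongrightarrow> 0"
      by (rule Lim_null_comparison[OF always_eventually lim]) (simp only: real_norm_def bound simp_thms)
    then show "y \<in> ?Y" by simp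
  qed
  then show ?case by blast
qed

section \<open>The orbit between successive visits\<close>

lemma op_product_fold:
  assumes "m \<le> n"
  shows "op_product P s n x = fold P (map s [Suc m..<Suc n]) (op_product P s m x)"
  using assms by (induction n rule: dec_induct) (auto simp del: upt_Suc simp: upt_Suc_append)

text \<open>If no time up to \<open>n\<close> has a value in \<open>J\<close>, the last visit is \<open>0\<close>, the time at which the orbit is
  at \<open>x\<close> itself. This matches the convention $l_0 = 0$ for the gaps, so that gap bounds hold
  from the start.\<close>

definition last_visit :: "(nat \<Rightarrow> nat) \<Rightarrow> nat set \<Rightarrow> nat \<Rightarrow> nat" where
  "last_visit s J n = Max (insert 0 {m \<in> {1..n}. s m \<in> J})"

lemma last_visit_props:
  "last_visit s J n \<le> n"
  "last_visit s J n = 0 \<or> s (last_visit s J n) \<in> J"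
  "m \<in> {1..n} \<Longrightarrow> s m \<in> J \<Longrightarrow> m \<le> last_visit s J n"
proof -
  let ?S = "insert 0 {m \<in> {1..n}. s m \<in> J}"
  have "last_visit s J n \<in> ?S" unfolding last_visit_def by (rule Max_in) auto
  then show "last_visit s J n \<le> n" "last_visit s J n = 0 \<or> s (last_visit s J n) \<in> J" by auto
  show "m \<in> {1..n} \<Longrightarrow> s m \<in> J \<Longrightarrow> m \<le> last_visit s J n"
    unfolding last_visit_def by (rule Max_ge) auto
qed

lemma filterlim_last_visit:
  assumes "infinite {m \<in> {1..}. s m \<in> J}"
  shows "filterlim (last_visit s J) at_top sequentially"
  unfolding filterlim_at_top eventually_sequentially
proof
  fix K
  obtain t where t: "t > K" "t \<ge> 1" "s t \<in> J"
    using assms by (auto simp: infinite_nat_iff_unbounded)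
  then have "K \<le> last_visit s J n" if "n \<ge> t" for n
    using last_visit_props(3)[of t n s J] that by simp
  then show "\<exists>N. \<forall>n\<ge>N. K \<le> last_visit s J n" by blast
qed

lemma last_visit_bounded_gap:
  assumes inf: "infinite (occurrences s j)" and gap: "max_gap s j < \<infinity>"
  shows "\<exists>M. \<forall>n. n - last_visit s {j} n \<le> M"
proof -
  let ?l = "occurrence_seq s j"
  obtain M where M: "max_gap s j = enat M" using gap by auto
  have step: "?l (Suc k) - ?l k \<le> M" for k
  proof -
    have "enat (?l (Suc k) - ?l (Suc k - 1)) \<le> max_gap s j"
      unfolding max_gap_def by (rule SUP_upper) simp
    then show ?thesis by (simp add: M)
  qed
  have occ: "?l k = 0 \<or> ?l k \<in> occurrences s j" for k
    using enumerate_in_set[OF inf] by (simp add: occurrence_seq_def)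
  have "n - last_visit s {j} n \<le> M" for n
  proof -
    have big: "k \<le> ?l (Suc k)" for k
      using le_enumerate[OF inf] by (simp add: occurrence_seq_def)
    \<comment> \<open>This \<open>k\<close> locates \<open>n\<close> between two consecutive occurrences: \<open>?l k \<le> n < ?l (Suc k)\<close>.\<close>
    define k where "k = (LEAST k. n < ?l (Suc k))"
    have ex: "n < ?l (Suc (Suc n))" using big[of "Suc n"] by simp
    have k: "n < ?l (Suc k)" unfolding k_def by (rule LeastI[where P = "\<lambda>k. n < ?l (Suc k)", OF ex])
    have kn: "?l k \<le> n"
    proof (cases k)
      case 0
      then show ?thesis by (simp add: occurrence_seq_def)
    next
      case (Suc k')
      then have "k' < (LEAST k. n < ?l (Suc k))" by (simp add: k_def)
      from not_less_Least[OF this] show ?thesis using Suc by simp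
    qed
    have "?l k \<le> last_visit s {j} n"
      using occ[of k] kn last_visit_props(3)[of "?l k" n s "{j}"] by (auto simp: occurrences_def)
    then show ?thesis using step[of k] k by linarith
  qed
  then show ?thesis by blast
qed

locale projection_orbit =
  fixes P :: "nat \<Rightarrow> 'a::{real_inner,complete_space} \<Rightarrow> 'a" and s :: "nat \<Rightarrow> nat"
  assumes proj: "i \<in> s ` {1..} \<Longrightarrow> projection scaleR inner (P i)"
begin

abbreviation orbit where "orbit x n \<equiv> op_product P s n x"

abbreviation word where "word m n \<equiv> map s [Suc m..<Suc n]"

lemma word_subset: "set (word m n) \<subseteq> s ` {1..}"
  by auto

lemma proj_word: "i \<in> set (word m n) \<Longrightarrow> projection scaleR inner (P i)"
  by (rule proj[OF subsetD[OF word_subset]])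

lemma energy_loss_word_nonneg: "energy_loss P (word m n) x \<ge> 0"
  by (rule energy_loss_nonneg) (rule proj_word)

lemma orbit_from_start: "orbit x n = fold P (word 0 n) x"
  using op_product_fold[of 0 n P s x] by simp

lemma norm_orbit_le: "norm (orbit x n) \<le> norm x"
  unfolding orbit_from_start by (rule norm_fold_le[OF proj_word])

lemma energy_loss_orbit:
  "m \<le> n \<Longrightarrow> energy_loss P (word m n) (orbit x m) = (norm (orbit x m))\<^sup>2 - (norm (orbit x n))\<^sup>2"
  using op_product_fold[of m n P s x] by (simp add: energy_loss_def)

text \<open>Both squared norms have the same limit, however large the time spans \<open>n - m n\<close> are.\<close>

lemma energy_loss_vanishes:
  assumes "filterlim m at_top sequentially" and "\<And>n. m n \<le> n"
  shows "(\<lambda>n. energy_loss P (word (m n) n) (orbit x (m n))) \<longlonglongrightarrow> 0"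
proof -
  have "decseq (\<lambda>n. (norm (orbit x n))\<^sup>2)"
  proof (rule antimonoI)
    fix i j :: nat assume "i \<le> j"
    then show "(norm (orbit x j))\<^sup>2 \<le> (norm (orbit x i))\<^sup>2"
      using energy_loss_word_nonneg[of i j "orbit x i"] energy_loss_orbit[of i j x] by linarith
  qed
  then obtain l where l: "(\<lambda>n. (norm (orbit x n))\<^sup>2) \<longlonglongrightarrow> l"
    by (rule decseq_convergent[of _ 0]) auto
  have "(\<lambda>n. (norm (orbit x (m n)))\<^sup>2 - (norm (orbit x n))\<^sup>2) \<longlonglongrightarrow> l - l"
    by (intro tendsto_diff l filterlim_compose[OF l assms(1)])
  then show ?thesis using energy_loss_orbit[OF assms(2)] by simp
qed

text \<open>At a visit to \<open>J\<close> the orbit has just entered the range of some \<open>P i\<close> with \<open>y\<close> in its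
  kernel, so it is orthogonal to \<open>y\<close> there.\<close>

lemma orbit_weak_null_if_return:
  assumes visits: "infinite {m \<in> {1..}. s m \<in> J}"
    and ker: "\<And>i. i \<in> J \<Longrightarrow> i \<in> s ` {1..} \<Longrightarrow> P i y = 0"
    and return: "(\<lambda>n. inner (orbit x (last_visit s J n) - orbit x n) y) \<longlonglongrightarrow> 0"
  shows "(\<lambda>n. inner (orbit x n) y) \<longlonglongrightarrow> 0"
proof -
  have zero: "inner (orbit x k) y = 0" if "k \<ge> 1" "s k \<in> J" for k
  proof -
    obtain k' where "k = Suc k'" using \<open>k \<ge> 1\<close> by (cases k) auto
    then show ?thesis
      using projectionD(3)[OF proj[of "s k"]] ker[of "s k"] that by simp
  qed
  have "eventually (\<lambda>n. 1 \<le> last_visit s J n) sequentially"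
    using filterlim_last_visit[OF visits] by (simp add: filterlim_at_top)
  then have "eventually (\<lambda>n. - inner (orbit x (last_visit s J n) - orbit x n) y = inner (orbit x n) y) sequentially"
  proof (rule eventually_mono)
    fix n assume "1 \<le> last_visit s J n"
    then show "- inner (orbit x (last_visit s J n) - orbit x n) y = inner (orbit x n) y"
      using zero last_visit_props(2)[of s J n] by (simp add: inner_diff_left)
  qed
  moreover have "(\<lambda>n. - inner (orbit x (last_visit s J n) - orbit x n) y) \<longlonglongrightarrow> 0"
    using tendsto_minus[OF return] by simp
  ultimately show ?thesis by (rule Lim_transform_eventually[rotated])
qed

lemma orbit_weak_null_bounded_gap:
  assumes inf: "infinite (occurrences s j)" and gap: "max_gap s j < \<infinity>" and y: "P j y = 0"
  shows "(\<lambda>n. inner (orbit x n) y) \<longlonglongrightarrow> 0"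
proof (rule orbit_weak_null_if_return)
  let ?m = "last_visit s {j}"
  let ?E = "\<lambda>n. energy_loss P (word (?m n) n) (orbit x (?m n))"
  show vis: "infinite {m \<in> {1..}. s m \<in> {j}}"
    using inf by (simp add: occurrences_def)
  obtain M where M: "\<And>n. n - ?m n \<le> M" using last_visit_bounded_gap[OF inf gap] by blast
  have E: "?E \<longlonglongrightarrow> 0"
    by (intro energy_loss_vanishes filterlim_last_visit vis last_visit_props(1))
  have "norm (inner (orbit x (?m n) - orbit x n) y) \<le> sqrt (M * ?E n) * norm y" for n
  proof -
    have "(norm (orbit x (?m n) - orbit x n))\<^sup>2 \<le> length (word (?m n) n) * ?E n"
      unfolding op_product_fold[of "?m n" n P s x, OF last_visit_props(1)]
      by (rule norm_displacement_sq_le) (rule proj_word)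
    also have "\<dots> \<le> M * ?E n"
      using M[of n] energy_loss_word_nonneg[of "?m n" n "orbit x (?m n)"]
      by (intro mult_right_mono) auto
    finally have "norm (orbit x (?m n) - orbit x n) \<le> sqrt (M * ?E n)"
      by (rule real_le_rsqrt)
    then show ?thesis
      unfolding real_norm_def
      by (intro order_trans[OF Cauchy_Schwarz_ineq2] mult_right_mono norm_ge_zero)
  qed
  note bound = this
  have "(\<lambda>n. sqrt (M * ?E n) * norm y) \<longlonglongrightarrow> sqrt (real M * 0) * norm y"
    by (intro tendsto_intros E)
  then have lim: "(\<lambda>n. sqrt (M * ?E n) * norm y) \<longlonglongrightarrow> 0" by simp
  show "(\<lambda>n. inner (orbit x (?m n) - orbit x n) y) \<longlonglongrightarrow> 0"
    by (rule Lim_null_comparison[OF always_eventually lim]) (intro allI bound)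
qed (use y in auto)

text \<open>The gaps between visits to \<open>{j..}\<close> may be unbounded, but only letters below \<open>j\<close> are used in
  between: a finite alphabet, even when the whole orbit uses infinitely many projections.\<close>

lemma orbit_weak_null_tail:
  assumes inf: "infinite (occurrences s j)"
    and ker: "\<And>i. i \<ge> j \<Longrightarrow> i \<in> s ` {1..} \<Longrightarrow> P i y = 0"
  shows "(\<lambda>n. inner (orbit x n) y) \<longlonglongrightarrow> 0"
proof (rule orbit_weak_null_if_return)
  let ?m = "last_visit s {j..}"
  have "occurrences s j \<subseteq> {m \<in> {1..}. s m \<in> {j..}}" by (auto simp: occurrences_def)
  then show vis: "infinite {m \<in> {1..}. s m \<in> {j..}}" using inf infinite_super by blast
  have "(\<lambda>n. inner (orbit x (?m n) - fold P (word (?m n) n) (orbit x (?m n))) y) \<longlonglongrightarrow> 0"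
  proof (rule words_over_finite_alphabet_weak_null)
    show "finite (s ` {1..} \<inter> {..<j})" by simp
    show "set (word (?m n) n) \<subseteq> s ` {1..} \<inter> {..<j}" for n
    proof
      fix i assume "i \<in> set (word (?m n) n)"
      then obtain k where k: "i = s k" "?m n < k" "k \<le> n" by auto
      then have "s k < j" using last_visit_props(3)[of k n s "{j..}"] by force
      then show "i \<in> s ` {1..} \<inter> {..<j}" using k by auto
    qed
    show "(\<lambda>n. energy_loss P (word (?m n) n) (orbit x (?m n))) \<longlonglongrightarrow> 0"
      by (intro energy_loss_vanishes filterlim_last_visit vis last_visit_props(1))
  qed (use proj norm_orbit_le in auto)
  then show "(\<lambda>n. inner (orbit x (?m n) - orbit x n) y) \<longlonglongrightarrow> 0"
    by (simp only: op_product_fold[of "?m _" _ P s x, OF last_visit_props(1), symmetric])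
  show "P i y = 0" if "i \<in> {j..}" "i \<in> s ` {1..}" for i
    using that by (intro ker) auto
qed

lemma orbit_weakly_converges:
  assumes Q: "projection scaleR inner Q" "range Q = (\<Inter>i\<in>s ` {1..}. range (P i))"
    and null: "\<And>j y. j \<in> s ` {1..} \<Longrightarrow> P j y = 0 \<Longrightarrow> (\<lambda>n. inner (orbit x n) y) \<longlonglongrightarrow> 0"
  shows "weakly_converges inner (orbit x) (Q x)"
proof -
  let ?Y = "{y. (\<lambda>n. inner (orbit x n - Q x) y) \<longlonglongrightarrow> 0}"
  have fixed: "P j (Q t) = Q t" if "j \<in> s ` {1..}" for j t
  proof -
    have "Q t \<in> (\<Inter>i\<in>s ` {1..}. range (P i))" unfolding Q(2)[symmetric] by (rule rangeI)
    from INT_D[OF this that] have "Q t \<in> range (P j)" .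
    then show ?thesis by (rule projection_range_iff[OF proj[OF that], THEN iffD1])
  qed
  have bd: "norm (orbit x n - Q x) \<le> norm x + norm (Q x)" for n
    using norm_orbit_le[where x = x and n = n] norm_triangle_ineq4[of "orbit x n" "Q x"] by simp
  have "?Y = UNIV"
  proof (rule closed_subspace_eq_UNIV[OF closed_subspace_weak_null[OF bd] proj])
    show "(\<Inter>i\<in>s ` {1..}. range (P i)) \<subseteq> ?Y"
      unfolding Q(2)[symmetric]
    proof
      fix y assume y: "y \<in> range Q"
      then obtain t where "y = Q t" by (rule rangeE)
      then have "P i y = y" if "i \<in> set (word 0 n)" for i n
        using fixed[OF subsetD[OF word_subset that]] by simp
      then have "inner (orbit x n) y = inner x y" for n
        unfolding orbit_from_start by (intro inner_fold_fixed conjI proj_word)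
      moreover have "inner (Q x) y = inner x y"
        using y projection_range_iff[OF Q(1)] projectionD(3)[OF Q(1)] by simp
      ultimately show "y \<in> ?Y" by (simp add: inner_diff_left)
    qed
  next
    fix j y assume j: "j \<in> s ` {1..}" and y: "P j y = 0"
    have "inner (Q x) y = 0"
      using fixed[OF j, of x] projectionD(3)[OF proj[OF j], of "Q x" y] y by simp
    then show "y \<in> ?Y" using null[OF j y] by (simp add: inner_diff_left)
  qed
  then have "(\<lambda>n. inner (orbit x n - Q x) y) \<longlonglongrightarrow> 0" for y by blast
  then show ?thesis
    by (simp add: weakly_converges_def inner_diff_left LIM_zero_iff)
qed

end

lemma projection_range_kernel_mono:
  assumes A: "projection scaleR inner A" and B: "projection scaleR inner B"
    and le: "\<And>x. inner (A x) x \<le> inner (B x) x"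
  shows "range A \<subseteq> range B" "B y = 0 \<Longrightarrow> A y = 0"
proof
  fix x assume "x \<in> range A"
  then have "A x = x" using projection_range_iff[OF A] by simp
  then have "(norm x)\<^sup>2 \<le> (norm (B x))\<^sup>2"
    using le[of x] by (simp add: projection_inner_self[OF B] power2_norm_eq_inner)
  then have "(norm (x - B x))\<^sup>2 \<le> 0" using projection_pythagoras[OF B, of x] by linarith
  then have "B x = x" by simp
  then show "x \<in> range B" by (metis rangeI)
next
  show "A y = 0" if "B y = 0"
    using le[of y] that by (simp add: projection_inner_self[OF A])
qed

section \<open>Weak convergence for pseudo-periodic products\<close>

theorem theorem2p8:
  fixes smul :: "'k::rc_field \<Rightarrow> 'a::{real_inner,complete_space} \<Rightarrow> 'a"
    and ip :: "'a \<Rightarrow> 'a \<Rightarrow> 'k"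
    and P :: "nat \<Rightarrow> 'a \<Rightarrow> 'a"
    and r :: nat
    and \<sigma> :: "nat \<Rightarrow> nat"
  assumes "hilbert_space smul ip"
    and "r \<ge> 1"
    and "\<And>i. i \<ge> 1 \<Longrightarrow> projection smul ip (P i)"
    and "inj_on P {1..r}"
    and "\<And>i. i \<ge> r + 1 \<Longrightarrow> op_le ip (P (i + 1)) (P i)"
    and "pseudo_periodic \<sigma>"
    and "Gamma_F \<sigma> = {1..r}"
  shows "(infinite (Gamma_inf \<sigma>) \<longrightarrow>
           (\<exists>Q. projection smul ip Q \<and> range Q = (\<Inter>i\<in>{1..}. range (P i)) \<and>
             (\<forall>x. weakly_converges ip (\<lambda>n. op_product P \<sigma> n x) (Q x)))) \<and>
         (\<exists>Q. projection smul ip Q \<and> range Q = (\<Inter>i\<in>\<sigma> ` {1..}. range (P i)) \<and>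
           (\<forall>x. weakly_converges ip (\<lambda>n. op_product P \<sigma> n x) (Q x)))"
proof -
  interpret hilbert_space smul ip by (rule assms(1))
  have img: "\<sigma> ` {1..} \<subseteq> {1..}" and rec: "\<And>j. j \<in> \<sigma> ` {1..} \<Longrightarrow> infinite (occurrences \<sigma> j)"
    using assms(6) by (auto simp: pseudo_periodic_def infinitely_recurrent_def)
  have projP: "projection scaleR inner (P i)" if "i \<ge> 1" for i
    by (rule projection_inner[OF assms(3)[OF that]])
  interpret projection_orbit P \<sigma> by unfold_locales (use img projP in auto)

  \<comment> \<open>The projections with index above \<open>r\<close> decrease, so their ranges shrink and their kernels grow.\<close>
  have drop: "inner (P (Suc i) x) x \<le> inner (P i x) x" if i: "i \<ge> r + 1" for i x
  proof -
    obtain t where "t \<ge> 0" "ip (P i x - P (Suc i) x) x = of_real t"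
      using assms(5)[OF i] by (auto simp: op_le_def elim!: nonneg_Reals_cases)
    then show ?thesis using inner_eq_if_ip_of_real by (fastforce simp: inner_diff_left)
  qed
  have le: "inner (P i x) x \<le> inner (P j x) x" if "r + 1 \<le> j" "j \<le> i" for i j x
    using that(2)
  proof (induction i rule: dec_induct)
    case (step i)
    then show ?case using drop[of i x] that(1) by linarith
  qed simp
  have mono: "range (P i) \<subseteq> range (P j)" "P j y = 0 \<Longrightarrow> P i y = 0" if "r + 1 \<le> j" "j \<le> i" for i j y
    using projection_range_kernel_mono[OF projP projP le[OF that]] that by auto

  have null: "(\<lambda>n. inner (op_product P \<sigma> n x) y) \<longlonglongrightarrow> 0"
    if j: "j \<in> \<sigma> ` {1..}" and y: "P j y = 0" for j x y
  proof (cases "j \<le> r")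
    case True
    then have "j \<in> Gamma_F \<sigma>" using j img assms(7) by auto
    then have "max_gap \<sigma> j < \<infinity>" by (simp add: Gamma_F_def)
    then show ?thesis by (rule orbit_weak_null_bounded_gap[OF rec[OF j] _ y])
  next
    case False
    then show ?thesis using mono(2)[OF _ _ y] by (intro orbit_weak_null_tail[OF rec[OF j]]) auto
  qed

  obtain Q where Q: "projection scaleR inner Q" "range Q = (\<Inter>i\<in>\<sigma> ` {1..}. range (P i))"
    using projection_onto_intersection[of "\<sigma> ` {1..}" P] proj by blast
  have "smul c y \<in> range Q" if "y \<in> range Q" for c y
  proof -
    have "smul c y \<in> range (P i)" if i: "i \<in> \<sigma> ` {1..}" for i
    proof -
      have "y \<in> range (P i)" using \<open>y \<in> range Q\<close> Q(2) i by blast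
      then obtain z where z: "y = P i z" by (rule rangeE)
      have "P i (smul c z) = smul c (P i z)"
        using assms(3)[of i] img i by (auto simp: projection_def bounded_operator_def)
      then have "smul c y = P i (smul c z)" using z by simp
      then show ?thesis by (rule range_eqI)
    qed
    then show ?thesis unfolding Q(2) by blast
  qed
  then have Qip: "projection smul ip Q" by (intro projection_ip Q(1))
  have conv: "weakly_converges ip (\<lambda>n. op_product P \<sigma> n x) (Q x)" for x
    by (intro weakly_converges_ip orbit_weakly_converges Q null)
  \<comment> \<open>With infinitely many exceptional values, every range beyond \<open>r\<close> contains one that is really visited.\<close>
  have "range Q = (\<Inter>i\<in>{1..}. range (P i))" if inf: "infinite (Gamma_inf \<sigma>)"
  proof -
    have "\<exists>j\<in>\<sigma> ` {1..}. range (P j) \<subseteq> range (P i)" if "i \<ge> 1" for i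
    proof (cases "i \<le> r")
      case True
      then have "i \<in> Gamma_F \<sigma>" using that assms(7) by auto
      then show ?thesis by (auto simp: Gamma_F_def)
    next
      case False
      obtain j where "j > i" "j \<in> \<sigma> ` {1..}"
        using inf by (auto simp: infinite_nat_iff_unbounded Gamma_inf_def)
      then show ?thesis using mono(1)[of i j] False by (intro bexI[of _ j]) auto
    qed
    then have "(\<Inter>i\<in>\<sigma> ` {1..}. range (P i)) \<subseteq> (\<Inter>i\<in>{1..}. range (P i))"
      by (intro INF_mono) auto
    moreover have "(\<Inter>i\<in>{1..}. range (P i)) \<subseteq> (\<Inter>i\<in>\<sigma> ` {1..}. range (P i))"
      using img by (rule INF_superset_mono) (rule order_refl)
    ultimately show ?thesis unfolding Q(2) by (rule equalityI)
  qed
  then show ?thesis using Qip Q(2) conv by blast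
qed

end
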